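(* Let $m\ge 2$ be an integer with $m\equiv 1\pmod 3$, let $f:\mathbb{Z}_3\to\mathbb{Z}_3$, $f(x)=x^m$, and let $t=\nu_3(m-1)$. 1. If $m\equiv 1\pmod 6$, then the minimal decomposition of $\mathbb{Z}_3$ for $f$ is $$\mathbb{Z}_3=\{0,\pm1\}\ \bigsqcup\ \Big(\bigcup_{l\ge0}\ \bigcup_{a=0}^{3^{t-1}-1}\ \bigcup_{i=1}^{2}\ \bigcup_{j=1}^{2}M_{l,a,i,j}\Big)\ \bigsqcup\ (3\mathbb{Z}_3\setminus\{0\}),$$ where $$M_{l,a,i,1}=1+3^{l+1}i+3^{l+2}a+3^{t+l+1}\mathbb{Z}_3,\qquad M_{l,a,i,2}=-1+3^{l+1}i+3^{l+2}a+3^{t+l+1}\mathbb{Z}_3 .$$ Here $\{0,\pm1\}$ is the set of periodic points (all of them fixed points), the $M_{l,a,i,j}$ are the minimal components, and $3\mathbb{Z}_3\setminus\{0\}$ is the attracting basin of the fixed point $0$. 2. If $m\equiv 4\pmod 6$, then the minimal decomposition of $\mathbb{Z}_3$ for $f$ is $$\mathbb{Z}_3=\{0,1\}\ \bigsqcup\ \Big(\bigcup_{l\ge0}\ \bigcup_{a=0}^{3^{t-1}-1}\ \bigcup_{i=1}^{2}M_{l,a,i}\Big)\ \bigsqcup\ \big((3\mathbb{Z}_3\setminus\{0\})\cup(2+3\mathbb{Z}_3)\big),$$ where $M_{l,a,i}=1+3^{l+1}i+3^{l+2}a+3^{t+l+1}\mathbb{Z}_3$. Here $\{0,1\}$ is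 the set of periodic points (all of them fixed points), the $M_{l,a,i}$ are the minimal components, and $(3\mathbb{Z}_3\setminus\{0\})\cup(2+3\mathbb{Z}_3)$ is the attracting basin (the part $\mathcal{B}$ of the minimal decomposition).
   Context: $\mathbb{Z}_3$ is the ring of $3$-adic integers with its $3$-adic metric, and $\nu_3$ is the $3$-adic valuation. For a polynomial $f$ over $\mathbb{Z}_p$, a minimal decomposition of $\mathbb{Z}_p$ for $f$ is a partition $\mathbb{Z}_p=\mathcal{P}\sqcup\mathcal{M}\sqcup\mathcal{B}$ where (1) $\mathcal{P}$ is the set of all periodic points of $f$; (2) $\mathcal{M}=\bigsqcup_i\mathcal{M}_i$ is a disjoint union of at most countably many clopen $f$-invariant sets, each a finite union of balls, such that each subsystem $f:\mathcal{M}_i\to\mathcal{M}_i$ is minimal (every forward orbit in $\mathcal{M}_i$ is dense in $\mathcal{M}_i$); the $\mathcal{M}_i$ are called minimal components; (3) each point of $\mathcal{B}$ lies in the attracting basin of a periodic orbit or of a minimal component. A point $x$ lies in the attracting basin of a closed invariant set $A$ if the distance from $f^n(x)$ to $A$ tends to $0$ as $n\to\infty$; in describing $\mathcal{B}$, the attracting set itself is not listed as part of its basin. *)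

theory Defs
  imports "HOL-Analysis.Analysis" "HOL-Number_Theory.Number_Theory"
begin

section \<open>The ring of 3-adic integers\<close>

text \<open>
  The inverse limit of the rings of integers modulo \<open>3 ^ n\<close>, whose elements are represented by the
  sequences of their least nonnegative residues. The equation below entails both
  \<open>0 \<le> x n < 3 ^ n\<close> and the compatibility of the residues.
\<close>

typedef three_adic = "{x :: nat \<Rightarrow> int. \<forall>n. x n = x (Suc n) mod 3 ^ n}"
  morphisms residue_mod three_adic_of
  by (rule exI[of _ "\<lambda>_. 0"]) simp

setup_lifting type_definition_three_adic

lemma three_adic_eqI: "(\<And>n. residue_mod x n = residue_mod y n) \<Longrightarrow> x = y"
  by (metis ext residue_mod_inject)

lemma residue_mod_mod: "residue_mod x n mod 3 ^ n = residue_mod x n"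
  using residue_mod[of x] by (metis (mono_tags, lifting) mem_Collect_eq mod_mod_trivial)

lemma mod_pow3_Suc: "(a mod 3 ^ Suc n) mod 3 ^ n = (a :: int) mod 3 ^ n"
  by (rule mod_mod_cancel) simp

instantiation three_adic :: comm_ring_1
begin

lift_definition zero_three_adic :: three_adic is "\<lambda>_. 0" by simp

lift_definition one_three_adic :: three_adic is "\<lambda>n. 1 mod 3 ^ n"
  by (simp only: mod_pow3_Suc simp_thms)

lift_definition plus_three_adic :: "three_adic \<Rightarrow> three_adic \<Rightarrow> three_adic"
  is "\<lambda>x y n. (x n + y n) mod 3 ^ n"
proof -
  fix x y :: "nat \<Rightarrow> int" and n
  assume "\<And>n. x n = x (Suc n) mod 3 ^ n" "\<And>n. y n = y (Suc n) mod 3 ^ n"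
  from this[of n] show "(x n + y n) mod 3 ^ n = (x (Suc n) + y (Suc n)) mod 3 ^ Suc n mod 3 ^ n"
    by (simp only: mod_pow3_Suc mod_add_eq)
qed

lift_definition uminus_three_adic :: "three_adic \<Rightarrow> three_adic"
  is "\<lambda>x n. (- x n) mod 3 ^ n"
proof -
  fix x :: "nat \<Rightarrow> int" and n
  assume "\<And>n. x n = x (Suc n) mod 3 ^ n"
  from this[of n] show "(- x n) mod 3 ^ n = (- x (Suc n)) mod 3 ^ Suc n mod 3 ^ n"
    by (simp only: mod_pow3_Suc mod_minus_eq)
qed

lift_definition minus_three_adic :: "three_adic \<Rightarrow> three_adic \<Rightarrow> three_adic"
  is "\<lambda>x y n. (x n - y n) mod 3 ^ n"
proof -
  fix x y :: "nat \<Rightarrow> int" and n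
  assume "\<And>n. x n = x (Suc n) mod 3 ^ n" "\<And>n. y n = y (Suc n) mod 3 ^ n"
  from this[of n] show "(x n - y n) mod 3 ^ n = (x (Suc n) - y (Suc n)) mod 3 ^ Suc n mod 3 ^ n"
    by (simp only: mod_pow3_Suc mod_diff_eq)
qed

lift_definition times_three_adic :: "three_adic \<Rightarrow> three_adic \<Rightarrow> three_adic"
  is "\<lambda>x y n. (x n * y n) mod 3 ^ n"
proof -
  fix x y :: "nat \<Rightarrow> int" and n
  assume "\<And>n. x n = x (Suc n) mod 3 ^ n" "\<And>n. y n = y (Suc n) mod 3 ^ n"
  from this[of n] show "(x n * y n) mod 3 ^ n = (x (Suc n) * y (Suc n)) mod 3 ^ Suc n mod 3 ^ n"
    by (simp only: mod_pow3_Suc mod_mult_eq)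
qed

lemmas residue_mod_simps =
  zero_three_adic.rep_eq one_three_adic.rep_eq plus_three_adic.rep_eq uminus_three_adic.rep_eq
  minus_three_adic.rep_eq times_three_adic.rep_eq residue_mod_mod

instance
proof
  fix a b c :: three_adic
  show "a * b * c = a * (b * c)" "a * b = b * a" "1 * a = a"
    "a + b + c = a + (b + c)" "a + b = b + a" "0 + a = a" "- a + a = 0" "a - b = a + - b"
    "(a + b) * c = a * c + b * c"
    by (rule three_adic_eqI, simp add: residue_mod_simps mod_simps algebra_simps)+
  have "residue_mod 0 1 \<noteq> residue_mod 1 1" by (simp add: residue_mod_simps)
  then show "(0 :: three_adic) \<noteq> 1" by metis
qed

end

lemma residue_mod_of_nat: "residue_mod (of_nat a) n = int a mod 3 ^ n"
  by (induction a) (simp_all add: residue_mod_simps mod_simps)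

lemma residue_mod_eq_0: "3 ^ n dvd x \<Longrightarrow> residue_mod x n = 0"
proof (elim dvdE)
  fix y assume x: "x = 3 ^ n * y"
  have "residue_mod (of_nat (3 ^ n) * y) n = 0"
    unfolding times_three_adic.rep_eq residue_mod_of_nat by simp
  then show "residue_mod x n = 0" by (simp add: x)
qed

lemma pow3_dvd_bounded:
  fixes x :: three_adic
  assumes "x \<noteq> 0"
  shows "\<exists>k. \<forall>n. 3 ^ n dvd x \<longrightarrow> n \<le> k"
proof -
  obtain k where k: "residue_mod x k \<noteq> 0"
    using assms by (metis ext residue_mod_inject zero_three_adic.rep_eq)
  have "n \<le> k" if "3 ^ n dvd x" for n
    using that k residue_mod_eq_0[of k x] by (meson power_le_dvd nat_le_linear)
  then show ?thesis by blast
qed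

text \<open>Meaningful for nonzero arguments only.\<close>

definition valuation3 :: "three_adic \<Rightarrow> nat" where
  "valuation3 x = (GREATEST n. 3 ^ n dvd x)"

lemma le_valuation3: "x \<noteq> 0 \<Longrightarrow> 3 ^ n dvd x \<Longrightarrow> n \<le> valuation3 x"
  unfolding valuation3_def using pow3_dvd_bounded[of x] by (metis Greatest_le_nat)

lemma pow3_valuation3_dvd: "x \<noteq> 0 \<Longrightarrow> 3 ^ valuation3 x dvd x"
  unfolding valuation3_def using pow3_dvd_bounded[of x]
  by (metis (mono_tags, lifting) GreatestI_nat one_dvd power_0)

instantiation three_adic :: metric_space
begin

definition dist_three_adic :: "three_adic \<Rightarrow> three_adic \<Rightarrow> real" where
  "dist x y = (if x = y then 0 else (1 / 3) ^ valuation3 (x - y))"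

definition uniformity_three_adic :: "(three_adic \<times> three_adic) filter" where
  "(uniformity :: (three_adic \<times> three_adic) filter) =
     (INF e\<in>{0<..}. principal {(x, y). dist x y < e})"

definition open_three_adic :: "three_adic set \<Rightarrow> bool" where
  "open (U :: three_adic set) \<longleftrightarrow> (\<forall>x\<in>U. \<forall>\<^sub>F (x', y) in uniformity. x' = x \<longrightarrow> y \<in> U)"

instance
proof
  fix x y z :: three_adic
  show "dist x y = 0 \<longleftrightarrow> x = y"
    by (simp add: dist_three_adic_def)
  show "dist x y \<le> dist x z + dist y z"
  proof (cases "x = y \<or> x = z \<or> y = z")
    case True
    have "3 ^ n dvd a - b \<longleftrightarrow> 3 ^ n dvd b - a" for n and a b :: three_adic
      by (metis dvd_minus_iff minus_diff_eq)
    then have "valuation3 (a - b) = valuation3 (b - a)" for a b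
      by (simp add: valuation3_def)
    with True show ?thesis by (auto simp: dist_three_adic_def)
  next
    case False
    define n where "n = min (valuation3 (x - z)) (valuation3 (y - z))"
    have "3 ^ n dvd x - z" "3 ^ n dvd y - z"
      using False pow3_valuation3_dvd[of "x - z"] pow3_valuation3_dvd[of "y - z"]
      by (auto simp: n_def intro: power_le_dvd)
    then have "3 ^ n dvd (x - z) - (y - z)" by (rule dvd_diff)
    then have "3 ^ n dvd x - y" by simp
    then have "n \<le> valuation3 (x - y)" using False by (intro le_valuation3) auto
    then have "(1 / 3 :: real) ^ valuation3 (x - y) \<le> (1 / 3) ^ n"
      by (intro power_decreasing) auto
    also have "\<dots> \<le> (1 / 3) ^ valuation3 (x - z) + (1 / 3) ^ valuation3 (y - z)"
      by (auto simp: n_def min_def)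
    finally show ?thesis using False by (simp add: dist_three_adic_def)
  qed
qed (rule uniformity_three_adic_def open_three_adic_def)+

end

text \<open>The coset \<open>c + 3 ^ k \<int>\<^sub>3\<close>.\<close>

definition coset3 :: "three_adic \<Rightarrow> nat \<Rightarrow> three_adic set" where
  "coset3 c k = range (\<lambda>z. c + 3 ^ k * z)"


section \<open>Minimal decompositions\<close>

definition forward_orbit :: "('a \<Rightarrow> 'a) \<Rightarrow> 'a \<Rightarrow> 'a set" where
  "forward_orbit f x = range (\<lambda>n. (f ^^ n) x)"

definition periodic_points :: "('a \<Rightarrow> 'a) \<Rightarrow> 'a set" where
  "periodic_points f = {x. \<exists>n>0. (f ^^ n) x = x}"

definition attracting_basin :: "('a::metric_space \<Rightarrow> 'a) \<Rightarrow> 'a set \<Rightarrow> 'a set" where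
  "attracting_basin f A = {x. (\<lambda>n. infdist ((f ^^ n) x) A) \<longlonglongrightarrow> 0}"

definition finite_union_of_balls :: "'a::metric_space set \<Rightarrow> bool" where
  "finite_union_of_balls A \<longleftrightarrow>
     (\<exists>F. finite F \<and> (\<forall>(x, r)\<in>F. r > 0) \<and> A = (\<Union>(x, r)\<in>F. ball x r))"

definition minimal_component :: "('a::metric_space \<Rightarrow> 'a) \<Rightarrow> 'a set \<Rightarrow> bool" where
  "minimal_component f A \<longleftrightarrow>
     A \<noteq> {} \<and> open A \<and> closed A \<and> finite_union_of_balls A \<and> f ` A \<subseteq> A \<and>
     (\<forall>x\<in>A. A \<subseteq> closure (forward_orbit f x))"

text \<open>The sets whose basins make up the third part of a minimal decomposition.\<close>

definition attractors :: "('a \<Rightarrow> 'a) \<Rightarrow> 'i set \<Rightarrow> ('i \<Rightarrow> 'a set) \<Rightarrow> 'a set set" where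
  "attractors f I M = forward_orbit f ` periodic_points f \<union> M ` I"

definition minimal_decomposition ::
    "('a::metric_space \<Rightarrow> 'a) \<Rightarrow> 'a set \<Rightarrow> 'i set \<Rightarrow> ('i \<Rightarrow> 'a set) \<Rightarrow> 'a set \<Rightarrow> bool" where
  "minimal_decomposition f P I M B \<longleftrightarrow>
     P \<union> (\<Union>i\<in>I. M i) \<union> B = UNIV \<and>
     P \<inter> (\<Union>i\<in>I. M i) = {} \<and> P \<inter> B = {} \<and> (\<Union>i\<in>I. M i) \<inter> B = {} \<and>
     P = periodic_points f \<and>
     countable I \<and> disjoint_family_on M I \<and> (\<forall>i\<in>I. minimal_component f (M i)) \<and>
     (\<forall>x\<in>B. \<exists>A\<in>attractors f I M. x \<in> attracting_basin f A)"

end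

theory Submission imports Defs begin

text \<open>
  Write \<open>m = 1 + 3 ^ t * q\<close> with \<open>3\<close> not dividing \<open>q\<close>. For \<open>e \<in> {1, -1}\<close> fixed by the power map \<open>f\<close> and
  \<open>x = e + 3 ^ s * u\<close> with \<open>s \<ge> 1\<close>, lifting the exponent twice gives
  \<open>f^n x = x + 3 ^ (s + t + k) * (j * q * u + 3 * v)\<close> for \<open>n = 3 ^ k * j\<close>. If \<open>u\<close> is a unit, then
  \<open>x\<close> is not periodic, the coset \<open>x + 3 ^ (s + t) \<int>\<^sub>3\<close> is invariant, and an orbit that agrees with
  a point of this coset modulo \<open>3 ^ (s + t + k)\<close> can be continued, by solving a
  linear congruence for \<open>j\<close> modulo \<open>3\<close>, to one that agrees with it modulo \<open>3 ^ (s + t + k + 1)\<close>; hence the coset is minimal. Multiples of \<open>3\<close>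
  tend to \<open>0\<close>, and for even \<open>m\<close> the map identifies \<open>x\<close> with \<open>-x\<close>, which sends \<open>2 + 3 \<int>\<^sub>3\<close> into the
  attractors inside \<open>1 + 3 \<int>\<^sub>3\<close>.
\<close>

section \<open>Lifting the exponent at the prime 3\<close>

lemma power_one_plus_pow3:
  fixes u :: "'a :: comm_semiring_1"
  assumes "s \<ge> 1"
  shows "\<exists>v. (1 + 3 ^ s * u) ^ q = 1 + 3 ^ s * (of_nat q * u + 3 * v)"
proof (induction q)
  case 0
  show ?case by (intro exI[of _ 0]) simp
next
  case (Suc q)
  \<comment> \<open>The product of the two corrections carries \<open>3 ^ s\<close> twice; one
    factor \<open>3\<close> split off from the second copy makes it part of
    \<open>3 * v\<close>.\<close>
  obtain r where s: "s = Suc r" using assms by (cases s) auto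
  from Suc obtain v where v: "(1 + 3 ^ s * u) ^ q = 1 + 3 ^ s * (of_nat q * u + 3 * v)" ..
  have "(1 + 3 ^ s * u) ^ Suc q
      = 1 + 3 ^ s * (of_nat (Suc q) * u + 3 * (v + 3 ^ r * u * (of_nat q * u + 3 * v)))"
    unfolding power_Suc v by (simp add: s algebra_simps)
  then show ?case ..
qed

text \<open>In the binomial expansion the linear term gains one factor \<open>3\<close>, while the
  quadratic and the cubic term are divisible by \<open>3 ^ (s + 2)\<close> because
  \<open>s \<ge> 1\<close>.\<close>

lemma cube_one_plus_pow3:
  fixes u :: "'a :: comm_semiring_1"
  assumes "s \<ge> 1"
  shows "\<exists>v. (1 + 3 ^ s * u) ^ 3 = 1 + 3 ^ Suc s * (u + 3 * v)"
proof -
  obtain r where s: "s = Suc r" using assms by (cases s) auto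
  have "a * 3 = a + a + a" for a :: 'a
    using distrib_left[of a 2 1] by (simp add: mult_2_right)
  then have "(1 + y) ^ 3 = 1 + 3 * y + 3 * (y * y) + y * y * y" for y :: 'a
    by (simp add: power3_eq_cube algebra_simps)
  then have "(1 + 3 * x) ^ 3 = 1 + 9 * x + 27 * (x * x) + 27 * (x * x * x)" for x :: 'a
    by (simp add: mult_ac)
  from this[of "3 ^ r * u"]
  have "(1 + 3 ^ s * u) ^ 3 = 1 + 3 ^ Suc s * (u + 3 * (3 ^ r * u * u + 3 ^ r * 3 ^ r * u * u * u))"
    by (simp add: s algebra_simps)
  then show ?thesis ..
qed

lemma power_pow3_one_plus_pow3:
  fixes u :: "'a :: comm_semiring_1"
  assumes "s \<ge> 1"
  shows "\<exists>v. (1 + 3 ^ s * u) ^ (3 ^ k) = 1 + 3 ^ (s + k) * (u + 3 * v)"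
proof (induction k)
  case 0
  show ?case by (intro exI[of _ 0]) simp
next
  case (Suc k)
  then obtain v where v: "(1 + 3 ^ s * u) ^ (3 ^ k) = 1 + 3 ^ (s + k) * (u + 3 * v)" ..
  obtain w where w: "(1 + 3 ^ (s + k) * (u + 3 * v)) ^ 3 = 1 + 3 ^ Suc (s + k) * (u + 3 * v + 3 * w)"
    using cube_one_plus_pow3[of "s + k" "u + 3 * v"] assms by auto
  have "(1 + 3 ^ s * u) ^ (3 ^ Suc k) = ((1 + 3 ^ s * u) ^ (3 ^ k)) ^ 3"
    by (simp flip: power_mult add: mult.commute)
  also have "\<dots> = 1 + 3 ^ (s + Suc k) * (u + 3 * (v + w))"
    unfolding v w by (simp add: algebra_simps)
  finally show ?case ..
qed

text \<open>Combines \<open>k\<close> cubings with one \<open>q\<close>-th power. The generality of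
  commutative semirings allows two uses: on the natural number \<open>m\<close> and on 3-adic
  integers.\<close>

lemma lifting_the_exponent3:
  fixes u :: "'a :: comm_semiring_1"
  assumes "s \<ge> 1"
  shows "\<exists>v. (1 + 3 ^ s * u) ^ (3 ^ k * q) = 1 + 3 ^ (s + k) * (of_nat q * u + 3 * v)"
proof -
  obtain v where v: "(1 + 3 ^ s * u) ^ (3 ^ k) = 1 + 3 ^ (s + k) * (u + 3 * v)"
    using power_pow3_one_plus_pow3[OF assms] by blast
  obtain w where w: "(1 + 3 ^ (s + k) * (u + 3 * v)) ^ q
      = 1 + 3 ^ (s + k) * (of_nat q * (u + 3 * v) + 3 * w)"
    using power_one_plus_pow3[of "s + k" "u + 3 * v"] assms by auto
  have "(1 + 3 ^ s * u) ^ (3 ^ k * q) = 1 + 3 ^ (s + k) * (of_nat q * u + 3 * (of_nat q * v + w))"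
    unfolding power_mult v w by (simp add: algebra_simps)
  then show ?thesis ..
qed

section \<open>Divisibility by powers of 3 in the 3-adic integers\<close>

lemma residue_mod_Suc: "residue_mod x n = residue_mod x (Suc n) mod 3 ^ n"
  using residue_mod[of x] by blast

lemma residue_mod_add: "residue_mod x (n + k) mod 3 ^ n = residue_mod x n"
proof (induction k)
  case 0
  show ?case by (simp add: residue_mod_mod)
next
  case (Suc k)
  have "residue_mod x (n + k) = residue_mod x (Suc (n + k)) mod 3 ^ (n + k)"
    by (rule residue_mod_Suc)
  then have "residue_mod x (n + k) mod 3 ^ n = residue_mod x (n + Suc k) mod 3 ^ n"
    by (simp add: mod_mod_cancel le_imp_power_dvd)
  with Suc show ?case by simp
qed

lemma pow3_dvd_iff_residue_mod: "3 ^ n dvd x \<longleftrightarrow> residue_mod x n = 0"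
proof
  assume 0: "residue_mod x n = 0"
  \<comment> \<open>The quotient of \<open>x\<close> by \<open>3 ^ n\<close>: dropping the
    \<open>n\<close> lowest ternary digits, all zero here, shifts the residue at level
    \<open>n + k\<close> to level \<open>k\<close>.\<close>
  define y where "y = three_adic_of (\<lambda>k. residue_mod x (n + k) div 3 ^ n)"
  have "residue_mod x (n + k) div 3 ^ n = (residue_mod x (n + Suc k) div 3 ^ n) mod 3 ^ k" for k
  proof -
    have "residue_mod x (n + k) = residue_mod x (n + Suc k) mod (3 ^ n * 3 ^ k)"
      using residue_mod_Suc[of x "n + k"] by (simp only: power_add add_Suc_right)
    then show ?thesis by (simp add: zmod_zmult2_eq)
  qed
  then have "(\<lambda>k. residue_mod x (n + k) div 3 ^ n) \<in> {z. \<forall>k. z k = z (Suc k) mod 3 ^ k}" by blast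
  then have y: "residue_mod y k = residue_mod x (n + k) div 3 ^ n" for k
    unfolding y_def by (subst three_adic_of_inverse) (assumption | rule refl)+
  have "residue_mod (3 ^ n * y) k = residue_mod x k" for k
  proof -
    have "3 ^ n dvd residue_mod x (n + k)"
      using residue_mod_add[of x n k] 0 by (simp add: dvd_eq_mod_eq_0)
    then have "3 ^ n * residue_mod y k = residue_mod x (k + n)" by (simp add: y add.commute)
    moreover have "residue_mod (3 ^ n * y) k = (3 ^ n * residue_mod y k) mod 3 ^ k"
      using residue_mod_of_nat[of "3 ^ n" k] by (simp add: times_three_adic.rep_eq mod_simps)
    ultimately show ?thesis by (simp add: residue_mod_add)
  qed
  then have "3 ^ n * y = x" by (rule three_adic_eqI)
  then show "3 ^ n dvd x" by (metis dvd_triv_left)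
qed (rule residue_mod_eq_0)

lemma residue_mod_bounds: "0 \<le> residue_mod x n" "residue_mod x n < 3 ^ n"
  using residue_mod_mod[of x n] pos_mod_sign[of "3 ^ n" "residue_mod x n"]
    pos_mod_bound[of "3 ^ n" "residue_mod x n"] by simp_all

lemma pow3_dvd_diff_of_nat_iff:
  "(3 ^ n :: three_adic) dvd of_nat a - of_nat b \<longleftrightarrow> [a = b] (mod 3 ^ n)"
proof -
  have "(3 ^ n :: three_adic) dvd of_nat a - of_nat b \<longleftrightarrow> (int a - int b) mod 3 ^ n = 0"
    by (simp add: pow3_dvd_iff_residue_mod minus_three_adic.rep_eq residue_mod_of_nat mod_simps)
  also have "\<dots> \<longleftrightarrow> [int a = int b] (mod int (3 ^ n))"
    by (simp add: cong_iff_dvd_diff mod_eq_0_iff_dvd)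
  finally show ?thesis by (simp only: cong_int_iff)
qed

lemma three_adic_approx:
  fixes x :: three_adic
  obtains r where "r < 3 ^ n" "3 ^ n dvd x - of_nat r"
proof -
  obtain r where r: "residue_mod x n = int r"
    using residue_mod_bounds(1) by (metis nonneg_int_cases)
  have "r < 3 ^ n" using residue_mod_bounds(2)[of x n] by (simp add: r)
  moreover have "3 ^ n dvd x - of_nat r"
    using residue_mod_mod[of x n]
    by (simp add: pow3_dvd_iff_residue_mod minus_three_adic.rep_eq residue_mod_of_nat r)
  ultimately show ?thesis by (rule that)
qed

text \<open>The residue of \<open>x\<close> at level \<open>n\<close> can be recovered from that of
  \<open>3 ^ k * x\<close> at level \<open>n + k\<close>. All cancellation of powers of 3 rests on
  this.\<close>

lemma pow3_mult_eq_0: "(3 :: three_adic) ^ k * x = 0 \<longleftrightarrow> x = 0"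
proof
  assume 0: "3 ^ k * x = 0"
  have "residue_mod x n = 0" for n
  proof -
    have "residue_mod (3 ^ k * x) (n + k) = (3 ^ k * residue_mod x (n + k)) mod 3 ^ (n + k)"
      using residue_mod_of_nat[of "3 ^ k" "n + k"] by (simp add: times_three_adic.rep_eq mod_simps)
    then have "3 ^ (n + k) dvd 3 ^ k * residue_mod x (n + k)"
      using 0 by (simp add: zero_three_adic.rep_eq dvd_eq_mod_eq_0)
    then have "3 ^ n dvd residue_mod x (n + k)"
      by (simp add: power_add mult.commute)
    then show ?thesis using residue_mod_add[of x n k] by (simp add: dvd_eq_mod_eq_0)
  qed
  then show "x = 0" by (intro three_adic_eqI) (simp add: zero_three_adic.rep_eq)
qed simp

lemma pow3_mult_cancel: "(3 :: three_adic) ^ k * x = 3 ^ k * y \<longleftrightarrow> x = y"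
  using pow3_mult_eq_0[of k "x - y"] by (simp add: right_diff_distrib)

lemma pow3_dvd_pow3_mult_iff: "(3 :: three_adic) ^ (k + n) dvd 3 ^ k * x \<longleftrightarrow> 3 ^ n dvd x"
  by (auto simp: dvd_def power_add mult.assoc pow3_mult_cancel)

text \<open>Divisibility by 3 is visible in the residue at level 1, so primality is inherited from
  the integer 3.\<close>

lemma prime_elem_3: "prime_elem (3 :: three_adic)"
proof (rule prime_elemI)
  show "(3 :: three_adic) \<noteq> 0" using pow3_mult_eq_0[of 1 1] by simp
  have dvd: "3 dvd x \<longleftrightarrow> 3 dvd residue_mod x 1" for x
    using pow3_dvd_iff_residue_mod[of 1 x] residue_mod_mod[of x 1] by auto
  show "\<not> (3 :: three_adic) dvd 1" by (simp add: dvd one_three_adic.rep_eq)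
  show "3 dvd a \<or> 3 dvd b" if "3 dvd a * b" for a b :: three_adic
  proof -
    have "3 dvd residue_mod a 1 * residue_mod b 1"
      using that by (simp add: dvd times_three_adic.rep_eq dvd_mod_iff)
    then show ?thesis by (simp add: dvd prime_dvd_mult_iff)
  qed
qed

lemma three_adic_mod3_cases:
  fixes x :: three_adic
  obtains "3 dvd x" | "3 dvd x - 1" | "3 dvd x + 1"
proof -
  obtain r where r: "r < 3" "3 dvd x - of_nat r" using three_adic_approx[of 1 x] by auto
  then consider "r = 0" | "r = 1" | "r = 2" by linarith
  then show ?thesis
  proof cases
    case 3
    have "3 dvd (x - of_nat r) + 3" using r(2) by (intro dvd_add) auto
    then show ?thesis using that(3) 3 by (simp add: algebra_simps)
  qed (use that r in auto)
qed

text \<open>Dividing by the largest possible power of 3 leaves a unit, since otherwise the valuation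
  could be increased.\<close>

lemma three_adic_split:
  fixes x :: three_adic
  assumes "x \<noteq> 0"
  obtains k y where "x = 3 ^ k * y" "\<not> 3 dvd y"
proof -
  obtain y where y: "x = 3 ^ valuation3 x * y"
    using pow3_valuation3_dvd[OF assms] by (elim dvdE)
  have "\<not> 3 dvd y"
  proof
    assume "3 dvd y"
    then have "3 ^ (valuation3 x + 1) dvd x"
      using pow3_dvd_pow3_mult_iff[of "valuation3 x" 1 y] y by simp
    then show False using le_valuation3[OF assms] by fastforce
  qed
  with y that show ?thesis by blast
qed

section \<open>Cosets as open and closed balls\<close>

lemma dist_three_adic_le_iff: "dist x y \<le> (1 / 3) ^ k \<longleftrightarrow> 3 ^ k dvd x - y" for x y :: three_adic
proof (cases "x = y")
  case False
  then have "3 ^ k dvd x - y \<longleftrightarrow> k \<le> valuation3 (x - y)"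
    using le_valuation3[of "x - y"] pow3_valuation3_dvd[of "x - y"] by (auto intro: power_le_dvd)
  with False show ?thesis
    by (simp add: dist_three_adic_def power_decreasing_iff)
qed simp

text \<open>Nonzero distances are powers of \<open>1 / 3\<close>, and \<open>2 * (1 / 3) ^ k\<close>
  lies strictly between two consecutive ones. This radius exhibits a coset as an open ball.\<close>

lemma dist_three_adic_less_iff: "dist x y < 2 * (1 / 3) ^ k \<longleftrightarrow> 3 ^ k dvd x - y" for x y :: three_adic
proof
  assume "3 ^ k dvd x - y"
  then have "dist x y \<le> (1 / 3) ^ k" by (simp add: dist_three_adic_le_iff)
  also have "\<dots> < 2 * (1 / 3) ^ k" by simp
  finally show "dist x y < 2 * (1 / 3) ^ k" .
next
  assume less: "dist x y < 2 * (1 / 3) ^ k"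
  show "3 ^ k dvd x - y"
  proof (cases "x = y")
    case False
    have "k \<le> valuation3 (x - y)"
    proof (rule ccontr)
      assume "\<not> k \<le> valuation3 (x - y)"
      then have "(1 / 3 :: real) ^ k \<le> (1 / 3) ^ Suc (valuation3 (x - y))"
        by (intro power_decreasing) auto
      moreover have "dist x y = (1 / 3) ^ valuation3 (x - y)"
        using False by (simp add: dist_three_adic_def)
      moreover have "(1 / 3 :: real) ^ k > 0" by simp
      ultimately show False using less unfolding power_Suc by linarith
    qed
    then show ?thesis using False pow3_valuation3_dvd[of "x - y"] by (auto intro: power_le_dvd)
  qed simp
qed

lemma mem_coset3_iff: "x \<in> coset3 c k \<longleftrightarrow> 3 ^ k dvd x - c"
  by (auto simp: coset3_def dvd_def image_iff algebra_simps)

lemma coset3_eq_ball: "coset3 c k = ball c (2 * (1 / 3) ^ k)"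
  by (auto simp: mem_coset3_iff dist_three_adic_less_iff[symmetric] dist_commute)

lemma coset3_eq_cball: "coset3 c k = cball c ((1 / 3) ^ k)"
  by (auto simp: mem_coset3_iff dist_three_adic_le_iff[symmetric] dist_commute)

lemma finite_union_of_balls_coset3: "finite_union_of_balls (coset3 c k)"
  unfolding finite_union_of_balls_def coset3_eq_ball
  by (rule exI[of _ "{(c, 2 * (1 / 3) ^ k)}"]) simp

text \<open>By the ultrametric inequality, a point closer than \<open>(1 / 3) ^ k\<close> to a point
  of the coset belongs to the coset.\<close>

lemma infdist_coset3_ge:
  assumes "x \<in> coset3 c k" "A \<noteq> {}" "A \<inter> coset3 c k = {}"
  shows "infdist x A \<ge> (1 / 3) ^ k"
proof -
  have "dist x a \<ge> (1 / 3) ^ k" if "a \<in> A" for a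
  proof (rule ccontr)
    assume "\<not> ?thesis"
    then have "3 ^ k dvd x - a" by (simp flip: dist_three_adic_le_iff)
    then have "3 ^ k dvd (x - c) - (x - a)"
      using assms(1) unfolding mem_coset3_iff by (rule dvd_diff[rotated])
    then have "a \<in> coset3 c k" by (simp add: mem_coset3_iff)
    with that assms(3) show False by blast
  qed
  with assms(2) show ?thesis by (simp add: infdist_def cINF_greatest)
qed

section \<open>Residue classes modulo 3\<close>

lemma three_dvd_of_nat_iff: "(3 :: three_adic) dvd of_nat a \<longleftrightarrow> 3 dvd a"
  using pow3_dvd_diff_of_nat_iff[of 1 a 0] by (simp add: cong_0_iff)

lemma coset3_mod3_cases:
  obtains "x \<in> coset3 0 1" | "x \<in> coset3 1 1" | "x \<in> coset3 (-1) 1"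
  using three_adic_mod3_cases[of x] by (auto simp: mem_coset3_iff)

text \<open>The theorem names this class by \<open>2\<close>; the arguments use \<open>-1\<close>,
  which is fixed for odd exponents and is the negative of the fixed point \<open>1\<close>.\<close>

lemma coset3_2_eq: "coset3 2 1 = coset3 (-1) 1"
proof -
  have "3 dvd x - 2 \<longleftrightarrow> 3 dvd x + 1" for x :: three_adic
    using dvd_add_right_iff[of 3 3 "x - 2"] by (simp add: algebra_simps)
  then show ?thesis by (auto simp: mem_coset3_iff)
qed

lemma coset3_mod3_disjoint:
  "coset3 0 1 \<inter> coset3 1 1 = {}" "coset3 0 1 \<inter> coset3 (-1) 1 = {}" "coset3 1 1 \<inter> coset3 (-1) 1 = {}"
proof -
  have *: "coset3 (of_nat a) 1 \<inter> coset3 (of_nat b) 1 = {}" if "\<not> [a = b] (mod 3)" for a b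
  proof (rule ccontr)
    assume "\<not> ?thesis"
    then obtain x :: three_adic where "3 dvd x - of_nat b" "3 dvd x - of_nat a"
      by (auto simp: mem_coset3_iff)
    then have "3 dvd (x - of_nat b) - (x - of_nat a)" by (rule dvd_diff)
    then show False using that pow3_dvd_diff_of_nat_iff[of 1 a b] by simp
  qed
  have "coset3 (-1) 1 = coset3 (of_nat 2) 1" by (simp only: coset3_2_eq of_nat_numeral)
  then show "coset3 0 1 \<inter> coset3 1 1 = {}" "coset3 0 1 \<inter> coset3 (-1) 1 = {}" "coset3 1 1 \<inter> coset3 (-1) 1 = {}"
    using *[of 0 1] *[of 0 2] *[of 1 2] by (simp_all add: cong_def)
qed

text \<open>Modulo 3 a unit is \<open>1\<close> or \<open>-1\<close>, hence its own inverse: with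
  \<open>r\<close> the residue of \<open>w\<close>, the solution is \<open>r\<close> or
  \<open>2 * r\<close>, the latter standing for \<open>- r\<close>.\<close>

lemma linear_congruence_mod3:
  fixes a w :: three_adic
  assumes "\<not> 3 dvd a"
  obtains j :: nat where "3 dvd w - of_nat j * a"
proof -
  obtain r where r: "3 dvd w - of_nat r" using three_adic_approx[of 1 w] by auto
  show ?thesis
  proof (cases a rule: three_adic_mod3_cases)
    case 2
    then have "3 dvd (w - of_nat r) - of_nat r * (a - 1)"
      by (intro dvd_diff[OF r dvd_mult])
    then show ?thesis using that[of r] by (simp add: algebra_simps)
  next
    case 3
    then have "3 dvd (w - of_nat r) - of_nat (2 * r) * (a + 1) + 3 * of_nat r"
      by (intro dvd_add[OF dvd_diff[OF r dvd_mult] dvd_triv_left])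
    then show ?thesis using that[of "2 * r"] by (simp add: algebra_simps)
  qed (use assms in blast)
qed

section \<open>Iterates and attracting basins\<close>

lemma funpow_power_map: "((\<lambda>x. x ^ m) ^^ n) x = (x :: 'a :: monoid_mult) ^ (m ^ n)"
  by (induction n) (simp_all flip: power_mult add: mult.commute)

text \<open>The distances to \<open>A\<close> form a constant sequence, so their limit
  \<open>0\<close> is the distance of \<open>x\<close> itself. Fixed points thus never lie in a
  basin outside its attractor.\<close>

lemma attracting_basin_fixed_point:
  assumes "f x = x" "x \<in> attracting_basin f A" "closed A" "A \<noteq> {}"
  shows "x \<in> A"
proof -
  have "(f ^^ n) x = x" for n by (induction n) (simp_all add: assms(1))
  then have "(\<lambda>n :: nat. infdist x A) \<longlonglongrightarrow> 0"
    using assms(2) by (simp add: attracting_basin_def)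
  then have "infdist x A = 0" by (simp add: tendsto_const_iff)
  then show ?thesis using assms(3,4) by (simp add: in_closed_iff_infdist_zero)
qed

text \<open>An orbit trapped in a coset disjoint from \<open>A\<close> keeps distance at least
  \<open>(1 / 3) ^ k\<close> from \<open>A\<close>.\<close>

lemma attracting_basin_orbit_in_coset3:
  assumes "\<And>n. (f ^^ n) x \<in> coset3 c k" "A \<noteq> {}" "A \<inter> coset3 c k = {}"
  shows "x \<notin> attracting_basin f A"
proof
  assume "x \<in> attracting_basin f A"
  then have "(\<lambda>n. infdist ((f ^^ n) x) A) \<longlonglongrightarrow> 0" by (simp add: attracting_basin_def)
  then have "(1 / 3) ^ k \<le> (0 :: real)"
    by (rule LIMSEQ_le_const) (use infdist_coset3_ge[OF assms] in blast)
  then show False by (simp add: power_le_zero_eq)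
qed

lemma funpow_in_invariant: "f ` A \<subseteq> A \<Longrightarrow> x \<in> A \<Longrightarrow> (f ^^ n) x \<in> A"
  by (induction n) auto

text \<open>From the first step on, the orbits of \<open>x\<close> and \<open>y\<close> coincide, so
  the distance to \<open>A\<close> is \<open>0\<close>. This serves the pair \<open>x\<close>,
  \<open>- x\<close> for even exponents.\<close>

lemma attracting_basin_same_image:
  assumes "f x = f y" "y \<in> A" "f ` A \<subseteq> A"
  shows "x \<in> attracting_basin f A"
proof -
  have "(f ^^ Suc n) x \<in> A" for n
    using funpow_in_invariant[OF assms(3,2), of "Suc n"] assms(1) by (simp add: funpow_swap1)
  then have "infdist ((f ^^ n) x) A = 0" if "n \<ge> 1" for n
    using that by (metis Suc_le_D One_nat_def infdist_zero)
  then have "\<forall>\<^sub>F n in sequentially. infdist ((f ^^ n) x) A = 0"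
    by (auto simp: eventually_sequentially)
  then show ?thesis
    by (simp add: attracting_basin_def tendsto_eventually)
qed

lemma power_in_coset3_1:
  assumes "x \<in> coset3 1 1"
  shows "x ^ n \<in> coset3 1 1"
proof -
  obtain u where "x = 1 + 3 ^ 1 * u" using assms unfolding coset3_def by blast
  moreover obtain v where "(1 + 3 ^ 1 * u) ^ n = 1 + 3 ^ 1 * (of_nat n * u + 3 * v)"
    using power_one_plus_pow3[of 1 u n] by auto
  ultimately have "x ^ n - 1 = 3 ^ 1 * (of_nat n * u + 3 * v)" by simp
  then show ?thesis unfolding mem_coset3_iff by (metis dvd_triv_left)
qed

section \<open>The power map on multiples of 3\<close>

locale power_map =
  fixes m t q :: nat
  assumes m_eq: "m = 1 + 3 ^ t * q" and t_pos: "t \<ge> 1" and q_unit: "\<not> 3 dvd q"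
begin

lemma m_ge_2: "m \<ge> 2"
proof -
  have "3 ^ t * q \<noteq> 0" using q_unit by (auto intro: ccontr)
  then show ?thesis using m_eq by linarith
qed

text \<open>If some iterate is within \<open>1 / 3\<close> of \<open>0\<close>, the prime 3 divides
  a power of \<open>x\<close> and hence \<open>x\<close>. Conversely, if 3 divides \<open>x\<close>,
  then \<open>3 ^ n\<close> divides \<open>x ^ (m ^ n)\<close>, because
  \<open>n < m ^ n\<close>.\<close>

lemma attracting_basin_0: "attracting_basin (\<lambda>x :: three_adic. x ^ m) {0} = coset3 0 1"
proof (intro equalityI subsetI)
  fix x :: three_adic
  assume "x \<in> attracting_basin (\<lambda>x. x ^ m) {0}"
  then have "(\<lambda>n. dist (x ^ (m ^ n)) 0) \<longlonglongrightarrow> 0"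
    by (simp add: attracting_basin_def funpow_power_map infdist_def)
  then have "\<forall>\<^sub>F n in sequentially. dist (x ^ (m ^ n)) 0 < (1 / 3) ^ 1"
    by (rule order_tendstoD) simp
  then obtain n where "dist (x ^ (m ^ n)) 0 < (1 / 3) ^ 1"
    by (auto simp: eventually_sequentially)
  then have "3 dvd x ^ (m ^ n)"
    using dist_three_adic_le_iff[of "x ^ (m ^ n)" 0 1] by simp
  then have "3 dvd x" by (rule prime_elem_dvd_power[OF prime_elem_3])
  then show "x \<in> coset3 0 1" by (simp add: mem_coset3_iff)
next
  fix x :: three_adic
  assume "x \<in> coset3 0 1"
  then have x: "3 dvd x" by (simp add: mem_coset3_iff)
  have "dist (x ^ (m ^ n)) 0 \<le> (1 / 3) ^ n" for n
  proof -
    have "(3 :: three_adic) ^ n dvd 3 ^ (m ^ n)"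
      using m_ge_2 by (intro le_imp_power_dvd less_imp_le power_gt_expt) auto
    also have "3 ^ (m ^ n) dvd x ^ (m ^ n)" using x by (rule dvd_power_same)
    finally show ?thesis by (simp add: dist_three_adic_le_iff)
  qed
  then have "\<forall>\<^sub>F n in sequentially. norm (dist (x ^ (m ^ n)) 0) \<le> (1 / 3) ^ n" by simp
  moreover have "(\<lambda>n. (1 / 3 :: real) ^ n) \<longlonglongrightarrow> 0" by (rule LIMSEQ_power_zero) simp
  ultimately have "(\<lambda>n. dist (x ^ (m ^ n)) 0) \<longlonglongrightarrow> 0"
    by (rule Lim_null_comparison)
  then show "x \<in> attracting_basin (\<lambda>x. x ^ m) {0}"
    by (simp add: attracting_basin_def funpow_power_map infdist_def)
qed

text \<open>A periodic point is a power of itself with exponent at least 2, so its square divides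
  it; for a nonzero multiple of 3 the square has strictly larger valuation.\<close>

lemma not_periodic_coset3_0:
  assumes "x \<in> coset3 0 1" "x \<in> periodic_points (\<lambda>x :: three_adic. x ^ m)"
  shows "x = 0"
proof (rule ccontr)
  assume "x \<noteq> 0"
  obtain n where n: "n > 0" "x ^ (m ^ n) = x"
    using assms(2) by (auto simp: periodic_points_def funpow_power_map)
  have "2 \<le> m ^ n" 
    using m_ge_2 n(1) by (metis self_le_power dual_order.trans not_gr_zero zero_less_iff_neq_zero one_le_numeral)
  then have "x * x dvd x" using n(2) le_imp_power_dvd[of 2 "m ^ n" x] by (simp add: power2_eq_square)
  obtain k y where xy: "x = 3 ^ k * y" "\<not> 3 dvd y" using three_adic_split[OF \<open>x \<noteq> 0\<close>] .
  have "3 ^ (k + 1) dvd x * x"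
    using assms(1) xy(1) mult_dvd_mono[of 3 x "3 ^ k" x] by (simp add: mem_coset3_iff)
  then have "3 ^ (k + 1) dvd 3 ^ k * y"
    using \<open>x * x dvd x\<close> xy(1) dvd_trans by metis
  then show False using xy(2) pow3_dvd_pow3_mult_iff[of k 1 y] by simp
qed

end

section \<open>The power map near a fixed unit\<close>

locale power_map_fixed_unit = power_map +
  fixes e :: three_adic
  assumes e_square: "e * e = 1" and e_fixed: "e ^ m = e"
begin

lemma e_iterate: "e ^ (m ^ n) = e"
  by (induction n) (simp_all add: power_mult e_fixed)

text \<open>The exponent satisfies \<open>m ^ (3 ^ k * j) - 1 = 3 ^ (t + k) * Q\<close> with \<open>Q \<equiv> j * q (mod 3)\<close>, so that
  the exponent lifting applies twice: to \<open>m\<close> and to \<open>1 + 3 ^ s * (e * u)\<close>.\<close>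

lemma iterate_expansion:
  assumes "s \<ge> 1"
  shows "\<exists>v. (e + 3 ^ s * u) ^ (m ^ (3 ^ k * j))
    = e + 3 ^ s * u + 3 ^ (s + t + k) * (of_nat (j * q) * u + 3 * v)"
proof -
  obtain r where s: "s = Suc r" using assms by (cases s) auto
  obtain w where "m ^ (3 ^ k * j) = 1 + 3 ^ (t + k) * (j * q + 3 * w)"
    using lifting_the_exponent3[OF t_pos, of q k j] by (auto simp: m_eq)
  then obtain Q where Q: "m ^ (3 ^ k * j) = 1 + 3 ^ (t + k) * Q" "Q = j * q + 3 * w" by blast
  obtain v where v: "(1 + 3 ^ s * (e * u)) ^ (3 ^ (t + k) * Q)
      = 1 + 3 ^ (s + (t + k)) * (of_nat Q * (e * u) + 3 * v)"
    using lifting_the_exponent3[OF assms] by blast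
  \<comment> \<open>\<open>e\<close> is its own inverse, so it can be factored out, and the rest has
    the form required by exponent lifting.\<close>
  have factor: "e + 3 ^ s * u = e * (1 + 3 ^ s * (e * u))"
    using e_square by (simp add: algebra_simps flip: mult.assoc)
  have "(e + 3 ^ s * u) ^ (m ^ (3 ^ k * j))
      = e ^ (m ^ (3 ^ k * j)) * (1 + 3 ^ s * (e * u)) ^ (m ^ (3 ^ k * j))"
    unfolding factor power_mult_distrib ..
  also have "\<dots> = e * (1 + 3 ^ s * (e * u)) ^ (m ^ (3 ^ k * j))"
    by (simp only: e_iterate)
  also have "\<dots> = e * ((1 + 3 ^ s * (e * u)) * (1 + 3 ^ s * (e * u)) ^ (3 ^ (t + k) * Q))"
    by (simp only: Q(1) power_add power_one_right)
  also have "\<dots> = (e + 3 ^ s * u) * (1 + 3 ^ (s + t + k) * (of_nat Q * (e * u) + 3 * v))"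
    unfolding v factor by (simp add: add.assoc mult.assoc)
  also have "\<dots> = e + 3 ^ s * u + 3 ^ (s + t + k) *
      ((e * e) * of_nat Q * u + 3 * (e * v + 3 ^ r * u * (of_nat Q * (e * u) + 3 * v)))"
    by (simp add: s algebra_simps)
  also have "\<dots> = e + 3 ^ s * u + 3 ^ (s + t + k) *
      (of_nat (j * q) * u + 3 * (of_nat w * u + e * v + 3 ^ r * u * (of_nat Q * (e * u) + 3 * v)))"
    unfolding e_square by (simp add: Q(2) algebra_simps)
  finally show ?thesis ..
qed

text \<open>With \<open>n = 3 ^ k * j\<close> and \<open>j\<close> prime to 3, the displacement
  after \<open>n\<close> steps is \<open>3 ^ (s + t + k)\<close> times an element congruent to
  \<open>j * q * u\<close> modulo 3, which is a unit and so nonzero.\<close>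

lemma iterate_neq:
  assumes "s \<ge> 1" "\<not> 3 dvd u" "n > 0"
  shows "(e + 3 ^ s * u) ^ (m ^ n) \<noteq> e + 3 ^ s * u"
proof -
  obtain j where j: "n = 3 ^ multiplicity 3 n * j" "\<not> 3 dvd j"
    using multiplicity_decompose'[of n 3] assms(3) by auto
  obtain v where v: "(e + 3 ^ s * u) ^ (m ^ n)
      = e + 3 ^ s * u + 3 ^ (s + t + multiplicity 3 n) * (of_nat (j * q) * u + 3 * v)"
    using iterate_expansion[OF assms(1), of u "multiplicity 3 n" j] j(1) by metis
  have "\<not> 3 dvd of_nat (j * q) * u"
    using assms(2) j(2) q_unit
    by (simp only: prime_elem_dvd_mult_iff[OF prime_elem_3] three_dvd_of_nat_iff
        prime_dvd_mult_iff[of "3 :: nat", simplified] simp_thms)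
  then have "\<not> 3 dvd of_nat (j * q) * u + 3 * v"
    by (simp only: dvd_add_times_triv_right_iff dvd_add_left_iff[OF dvd_triv_left] simp_thms)
  then have "of_nat (j * q) * u + 3 * v \<noteq> 0" by (metis dvd_0_right)
  then show ?thesis unfolding v by (simp only: add_cancel_left_right pow3_mult_eq_0 simp_thms)
qed

lemma not_periodic:
  assumes "x \<in> coset3 e 1" "x \<noteq> e"
  shows "x \<notin> periodic_points (\<lambda>x. x ^ m)"
proof -
  obtain k y where ky: "x - e = 3 ^ k * y" "\<not> 3 dvd y"
    using three_adic_split[of "x - e"] assms(2) by auto
  have "k \<ge> 1" using assms(1) ky by (cases k) (auto simp: mem_coset3_iff)
  moreover have "x = e + 3 ^ k * y" using ky(1) by (simp add: algebra_simps)
  ultimately show ?thesis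
    using iterate_neq[OF _ ky(2)] by (auto simp: periodic_points_def funpow_power_map)
qed

text \<open>Induction on the precision: running the orbit \<open>3 ^ k * j\<close> steps further
  changes only digits from position \<open>s + t + k\<close> on, and the lowest of these can be
  prescribed through \<open>j\<close>.\<close>

lemma orbit_approx:
  assumes "s \<ge> 1" "\<not> 3 dvd u" "3 ^ (s + t) dvd y - (e + 3 ^ s * u)"
  shows "\<exists>n. 3 ^ (s + t + k) dvd y - (e + 3 ^ s * u) ^ (m ^ n)"
proof (induction k)
  case 0
  show ?case using assms(3) by (intro exI[of _ 0]) simp
next
  case (Suc k)
  define x where "x = e + 3 ^ s * u"
  from Suc obtain n w where w: "y - x ^ (m ^ n) = 3 ^ (s + t + k) * w"
    by (auto simp: x_def elim: dvdE)
  obtain v where v: "x ^ (m ^ n) = e + 3 ^ s * u + 3 ^ (s + t) * (of_nat (n * q) * u + 3 * v)"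
    using iterate_expansion[OF assms(1), of u 0 n] by (auto simp: x_def)
  \<comment> \<open>Recentring at the current iterate: \<open>u'\<close> differs from
    \<open>u\<close> by a multiple of 3, since \<open>t \<ge> 1\<close>, so the expansion applies
    again with a unit.\<close>
  define u' where "u' = u + 3 ^ t * (of_nat (n * q) * u + 3 * v)"
  have x': "x ^ (m ^ n) = e + 3 ^ s * u'" by (simp add: v u'_def power_add algebra_simps)
  have "\<not> 3 dvd u'"
  proof -
    have "3 dvd 3 ^ t * (of_nat (n * q) * u + 3 * v)"
      using t_pos by (intro dvd_mult2) (simp add: dvd_power)
    then show ?thesis using assms(2) by (simp only: u'_def dvd_add_left_iff simp_thms)
  qed
  then have "\<not> 3 dvd of_nat q * u'"
    using q_unit by (simp add: prime_elem_dvd_mult_iff[OF prime_elem_3] three_dvd_of_nat_iff)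
  \<comment> \<open>\<open>w\<close> is the current error divided by \<open>3 ^ (s + t + k)\<close>;
    the extra steps shift the orbit by \<open>of_nat j * (of_nat q * u')\<close> in these units,
    modulo 3.\<close>
  then obtain j where "3 dvd w - of_nat j * (of_nat q * u')" by (rule linear_congruence_mod3)
  then obtain w' where w': "w = of_nat j * (of_nat q * u') + 3 * w'"
    by (metis dvdE diff_eq_eq add.commute)
  obtain v' where "(x ^ (m ^ n)) ^ (m ^ (3 ^ k * j))
      = x ^ (m ^ n) + 3 ^ (s + t + k) * (of_nat (j * q) * u' + 3 * v')"
    using iterate_expansion[OF assms(1), of u' k j] unfolding x' by blast
  moreover have "x ^ (m ^ (n + 3 ^ k * j)) = (x ^ (m ^ n)) ^ (m ^ (3 ^ k * j))"
    by (metis power_add power_mult)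
  ultimately have "y - x ^ (m ^ (n + 3 ^ k * j))
      = 3 ^ (s + t + k) * w - 3 ^ (s + t + k) * (of_nat (j * q) * u' + 3 * v')"
    by (simp only: flip: w) simp
  also have "\<dots> = 3 ^ (s + t + Suc k) * (w' - v')"
    by (simp add: w' algebra_simps)
  finally show ?case unfolding x_def by (metis dvd_triv_left)
qed

text \<open>One step moves a point by a multiple of \<open>3 ^ (s + t)\<close>, which gives
  invariance; density of every orbit is \<open>orbit_approx\<close> at all precisions.\<close>

lemma minimal_component_coset3:
  assumes "s \<ge> 1" "\<not> 3 dvd u"
  shows "minimal_component (\<lambda>x. x ^ m) (coset3 (e + 3 ^ s * u) (s + t))"
  unfolding minimal_component_def
proof (intro conjI ballI subsetI)
  let ?C = "coset3 (e + 3 ^ s * u) (s + t)"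
  have "e + 3 ^ s * u \<in> ?C" by (simp add: mem_coset3_iff)
  then show "?C \<noteq> {}" by blast
  show "open ?C" by (simp add: coset3_eq_ball)
  show "closed ?C" by (simp add: coset3_eq_cball)
  show "finite_union_of_balls ?C" by (rule finite_union_of_balls_coset3)
  \<comment> \<open>Every point of the coset has the same shape as its center, so the expansions are
    available from any starting point.\<close>
  have unit: "\<exists>u'. x = e + 3 ^ s * u' \<and> \<not> 3 dvd u'" if x: "x \<in> ?C" for x
  proof -
    obtain z where "x = e + 3 ^ s * u + 3 ^ (s + t) * z" using x unfolding coset3_def by blast
    then have "x = e + 3 ^ s * (u + 3 ^ t * z)" by (simp add: power_add algebra_simps)
    moreover have "3 dvd 3 ^ t * z" using t_pos by (intro dvd_mult2) (simp add: dvd_power)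
    then have "\<not> 3 dvd u + 3 ^ t * z" using assms(2) by (simp only: dvd_add_left_iff simp_thms)
    ultimately show ?thesis by blast
  qed
  show "y \<in> ?C" if y: "y \<in> (\<lambda>x. x ^ m) ` ?C" for y
  proof -
    obtain x where x: "x \<in> ?C" "y = x ^ m" using y by blast
    obtain u' where u': "x = e + 3 ^ s * u'" using unit[OF x(1)] by blast
    have "3 ^ (s + t) dvd y - x"
      \<comment> \<open>The instance \<open>k = 0\<close>, \<open>j = 1\<close> describes a single
        application of the map.\<close>
      using iterate_expansion[OF assms(1), of u' 0 1] by (auto simp: x(2) u')
    then have "3 ^ (s + t) dvd (y - x) + (x - (e + 3 ^ s * u))"
      using x(1) unfolding mem_coset3_iff by (rule dvd_add)
    then show ?thesis by (simp only: mem_coset3_iff diff_add_cancel add_diff_eq)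
  qed
  fix x y
  assume x: "x \<in> ?C" and y: "y \<in> ?C"
  obtain u' where u': "x = e + 3 ^ s * u'" "\<not> 3 dvd u'" using unit[OF x] by blast
  have "3 ^ (s + t) dvd y - x"
    using dvd_diff[OF y[unfolded mem_coset3_iff] x[unfolded mem_coset3_iff]] by simp
  then have approx: "\<exists>n. 3 ^ (s + t + k) dvd y - x ^ (m ^ n)" for k
    using orbit_approx[OF assms(1) u'(2), of y] by (simp add: u'(1))
  show "y \<in> closure (forward_orbit (\<lambda>x. x ^ m) x)"
    unfolding closure_approachable
  proof (intro allI impI)
    fix \<epsilon> :: real
    assume "\<epsilon> > 0"
    then obtain k where k: "(1 / 3) ^ k < \<epsilon>" using real_arch_pow_inv[of \<epsilon> "1 / 3"] by auto
    obtain n where "3 ^ (s + t + k) dvd y - x ^ (m ^ n)" using approx by blast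
    then have "3 ^ k dvd y - x ^ (m ^ n)" by (rule power_le_dvd) simp
    then have "dist y (x ^ (m ^ n)) \<le> (1 / 3) ^ k" by (simp add: dist_three_adic_le_iff)
    with k have "dist (x ^ (m ^ n)) y < \<epsilon>" by (simp add: dist_commute)
    moreover have "x ^ (m ^ n) \<in> forward_orbit (\<lambda>x. x ^ m) x"
      by (auto simp: forward_orbit_def funpow_power_map)
    ultimately show "\<exists>z\<in>forward_orbit (\<lambda>x. x ^ m) x. dist z y < \<epsilon>" by blast
  qed
qed

end

section \<open>The indexing of the minimal components\<close>

definition component3 :: "nat \<Rightarrow> three_adic \<Rightarrow> nat \<Rightarrow> nat \<Rightarrow> nat \<Rightarrow> three_adic set" where
  "component3 t e l a i = coset3 (e + 3 ^ (l + 1) * of_nat i + 3 ^ (l + 2) * of_nat a) (t + l + 1)"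

text \<open>The pair \<open>a\<close>, \<open>i\<close> encodes the number \<open>i + 3 * a\<close>.
  Over the index ranges of the theorem it runs through the residues modulo \<open>3 ^ t\<close> that
  are prime to 3.\<close>

lemma component3_eq: "component3 t e l a i = coset3 (e + 3 ^ (l + 1) * of_nat (i + 3 * a)) (l + 1 + t)"
  by (simp add: component3_def algebra_simps)

lemma component3E:
  assumes "x \<in> component3 t e l a i" "t \<ge> 1" "i \<in> {1..2}"
  obtains u where "x = e + 3 ^ (l + 1) * u" "3 ^ t dvd u - of_nat (i + 3 * a)" "\<not> 3 dvd u"
proof -
  have "\<exists>z. x = e + 3 ^ (l + 1) * of_nat (i + 3 * a) + 3 ^ (l + 1 + t) * z"
    using assms(1) unfolding component3_eq coset3_def by blast
  then obtain z where z: "x = e + 3 ^ (l + 1) * of_nat (i + 3 * a) + 3 ^ (l + 1 + t) * z" ..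
  define u where "u = of_nat (i + 3 * a) + 3 ^ t * z"
  have "x = e + 3 ^ (l + 1) * u" by (simp add: z u_def power_add algebra_simps)
  moreover have "3 ^ t dvd u - of_nat (i + 3 * a)" by (simp add: u_def)
  moreover have "\<not> 3 dvd u"
  proof -
    have "\<not> 3 dvd i + 3 * a" using assms(3) by (simp only: atLeastAtMost_iff) presburger
    moreover have "3 dvd 3 ^ t * z" using assms(2) by (intro dvd_mult2) (simp add: dvd_power)
    ultimately show ?thesis by (simp only: u_def dvd_add_left_iff three_dvd_of_nat_iff simp_thms)
  qed
  ultimately show ?thesis by (rule that)
qed

text \<open>Were \<open>k'\<close> smaller, cancelling \<open>3 ^ k'\<close> would make
  \<open>u'\<close> a multiple of 3. Used in both directions, this determines the exponent.\<close>

lemma pow3_unit_unique_exponent: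
  fixes u u' :: three_adic
  assumes "3 ^ k * u = 3 ^ k' * u'" "\<not> 3 dvd u'"
  shows "k' \<ge> k"
proof (rule ccontr)
  assume "\<not> k' \<ge> k"
  then have "k = k' + Suc (k - Suc k')" by simp
  then have "3 ^ k' * (3 ^ Suc (k - Suc k') * u) = 3 ^ k' * u'"
    using assms(1) by (metis mult.assoc power_add)
  then have "3 ^ Suc (k - Suc k') * u = u'" by (simp only: pow3_mult_cancel)
  then show False using assms(2) by (auto simp: mult.assoc)
qed

text \<open>The valuation of \<open>x - e\<close> determines \<open>l\<close>, and the unit that
  remains, taken modulo \<open>3 ^ t\<close>, determines \<open>i + 3 * a\<close>.\<close>

lemma component3_unique:
  assumes t: "t \<ge> 1"
    and x: "x \<in> component3 t e l a i" "a \<in> {0..3 ^ (t - 1) - 1}" "i \<in> {1..2}"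
    and x': "x \<in> component3 t e l' a' i'" "a' \<in> {0..3 ^ (t - 1) - 1}" "i' \<in> {1..2}"
  shows "l = l' \<and> a = a' \<and> i = i'"
proof -
  obtain u where u: "x = e + 3 ^ (l + 1) * u" "3 ^ t dvd u - of_nat (i + 3 * a)" "\<not> 3 dvd u"
    using component3E[OF x(1) t x(3)] .
  obtain u' where u': "x = e + 3 ^ (l' + 1) * u'" "3 ^ t dvd u' - of_nat (i' + 3 * a')" "\<not> 3 dvd u'"
    using component3E[OF x'(1) t x'(3)] .
  have eq: "3 ^ (l + 1) * u = 3 ^ (l' + 1) * u'" using u(1) u'(1) by simp
  have l: "l = l'"
    using pow3_unit_unique_exponent[OF eq u'(3)] pow3_unit_unique_exponent[OF eq[symmetric] u(3)] by simp
  then have "u = u'" using eq by (simp only: pow3_mult_cancel)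
  then have "3 ^ t dvd (u - of_nat (i' + 3 * a')) - (u - of_nat (i + 3 * a))"
    using dvd_diff[OF u'(2) u(2)] by simp
  then have cong: "[i + 3 * a = i' + 3 * a'] (mod 3 ^ t)"
    by (simp only: diff_diff_eq2 diff_add_cancel pow3_dvd_diff_of_nat_iff[symmetric]) (simp add: algebra_simps)
  \<comment> \<open>Both encoded numbers are below the modulus, so their congruence is an
    equality.\<close>
  have less: "i + 3 * a < 3 ^ t" if "a \<in> {0..3 ^ (t - 1) - 1}" "i \<in> {1..2}" for a i :: nat
  proof -
    have "a < 3 ^ (t - 1)" using that(1) by (simp add: le_less_Suc_eq Suc_diff_1 flip: less_Suc_eq_le)
    moreover have "3 ^ t = 3 * (3 :: nat) ^ (t - 1)" using t by (cases t) auto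
    ultimately show ?thesis using that(2) by simp
  qed
  have "i + 3 * a = i' + 3 * a'"
    using cong less[OF x(2,3)] less[OF x'(2,3)] by (rule cong_less_modulus_unique_nat)
  moreover have "i \<in> {1, 2}" "i' \<in> {1, 2}" using x(3) x'(3) by auto
  ultimately have "i = i'" "a = a'" by auto presburger+
  with l show ?thesis by blast
qed

text \<open>The indices are read off from \<open>x - e = 3 ^ k * y\<close>: \<open>l\<close> is
  \<open>k - 1\<close>, and the residue \<open>r\<close> of \<open>y\<close> modulo
  \<open>3 ^ t\<close> gives \<open>a = r div 3\<close> and \<open>i = r mod 3\<close>.\<close>

lemma component3_cover:
  assumes t: "t \<ge> 1" and x: "x \<in> coset3 e 1" "x \<noteq> e"
  shows "\<exists>l. \<exists>a\<in>{0..3 ^ (t - 1) - 1}. \<exists>i\<in>{1..2}. x \<in> component3 t e l a i"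
proof -
  obtain k y where ky: "x - e = 3 ^ k * y" "\<not> 3 dvd y"
    using three_adic_split[of "x - e"] x(2) by auto
  have "k \<noteq> 0" using x(1) ky by (auto simp: mem_coset3_iff intro!: Nat.gr0I)
  then obtain l where l: "k = l + 1" by (metis Suc_eq_plus1 not0_implies_Suc)
  obtain r where r: "r < 3 ^ t" "3 ^ t dvd y - of_nat r" using three_adic_approx .
  have "(3 :: three_adic) dvd 3 ^ t" using t by (simp add: dvd_power)
  then have "3 dvd y - of_nat r" using r(2) by (rule dvd_trans)
  then have "\<not> 3 dvd r" using ky(2) dvd_diff_left_iff[of 3 "of_nat r" y] by (auto simp: three_dvd_of_nat_iff)
  then have "r mod 3 \<in> {1..2}" by (auto simp: dvd_eq_mod_eq_0)
  moreover have "r div 3 \<in> {0..3 ^ (t - 1) - 1}"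
  proof -
    have "3 ^ t = (3 :: nat) ^ (t - 1) * 3" using t by (cases t) auto
    then have "r div 3 < 3 ^ (t - 1)" using r(1) by (simp add: div_less_iff_less_mult)
    then show ?thesis by simp
  qed
  moreover have "x \<in> component3 t e l (r div 3) (r mod 3)"
  proof -
    have "x - (e + 3 ^ (l + 1) * of_nat r) = 3 ^ (l + 1) * (y - of_nat r)"
      using ky(1) by (simp add: l algebra_simps)
    then have "3 ^ (l + 1 + t) dvd x - (e + 3 ^ (l + 1) * of_nat r)"
      using r(2) by (simp only: pow3_dvd_pow3_mult_iff)
    then show ?thesis by (simp add: component3_eq mem_coset3_iff mod_mult_div_eq del: of_nat_add of_nat_mult)
  qed
  ultimately show ?thesis by blast
qed

lemma component3_subset:
  assumes "t \<ge> 1" "i \<in> {1..2}"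
  shows "component3 t e l a i \<subseteq> coset3 e 1 - {e}"
proof
  fix x
  assume "x \<in> component3 t e l a i"
  then obtain u where u: "x = e + 3 ^ (l + 1) * u" "\<not> 3 dvd u"
    using component3E[OF _ assms] by metis
  then have "u \<noteq> 0" by auto
  then have "3 ^ (l + 1) * u \<noteq> 0" by (simp only: pow3_mult_eq_0 not_False_eq_True)
  with u(1) show "x \<in> coset3 e 1 - {e}" by (auto simp: mem_coset3_iff)
qed

lemma Union_component3:
  assumes "t \<ge> 1"
  shows "(\<Union>l. \<Union>a\<in>{0..3 ^ (t - 1) - 1}. \<Union>i\<in>{1..2}. component3 t e l a i) = coset3 e 1 - {e}"
proof (intro equalityI subsetI)
  fix x assume "x \<in> coset3 e 1 - {e}"
  then show "x \<in> (\<Union>l. \<Union>a\<in>{0..3 ^ (t - 1) - 1}. \<Union>i\<in>{1..2}. component3 t e l a i)"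
    using component3_cover[OF assms, of x e] by blast
next
  fix x assume "x \<in> (\<Union>l. \<Union>a\<in>{0..3 ^ (t - 1) - 1}. \<Union>i\<in>{1..2}. component3 t e l a i)"
  then show "x \<in> coset3 e 1 - {e}" using component3_subset[OF assms] by blast
qed

lemma (in power_map_fixed_unit) minimal_component_component3:
  assumes "i \<in> {1..2}"
  shows "minimal_component (\<lambda>x. x ^ m) (component3 t e l a i)"
proof -
  have "\<not> 3 dvd i + 3 * a" using assms by (simp only: atLeastAtMost_iff) presburger
  then have "\<not> (3 :: three_adic) dvd of_nat (i + 3 * a)" by (simp only: three_dvd_of_nat_iff not_False_eq_True)
  then show ?thesis unfolding component3_eq by (intro minimal_component_coset3) simp_all
qed

lemma mem_coset3_self: "c \<in> coset3 c k"
  by (simp add: mem_coset3_iff)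

lemma fixed_point_periodic: "f x = x \<Longrightarrow> x \<in> periodic_points f"
  by (auto simp: periodic_points_def intro: exI[of _ 1])

lemma forward_orbit_fixed_point: "f x = x \<Longrightarrow> forward_orbit f x = {x}"
proof -
  assume "f x = x"
  then have "(f ^^ n) x = x" for n by (induction n) simp_all
  then show ?thesis by (auto simp: forward_orbit_def)
qed

section \<open>The decompositions for odd and even exponents\<close>

context power_map
begin

lemma decomposition_odd:
  assumes "odd m"
  shows "minimal_decomposition (\<lambda>x :: three_adic. x ^ m) {0, 1, -1}
    {(l, a, i, j). a \<in> {0..3 ^ (t - 1) - 1} \<and> i \<in> {1..2} \<and> j \<in> {1..2}}
    (\<lambda>(l :: nat, a :: nat, i :: nat, j :: nat). component3 t (if j = 1 then 1 else -1) l a i)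
    (coset3 0 1 - {0})"
  (is "minimal_decomposition ?f ?P ?I ?M ?B")
proof -
  interpret pos: power_map_fixed_unit m t q 1 by unfold_locales simp_all
  interpret neg: power_map_fixed_unit m t q "-1" by unfold_locales (simp_all add: assms)
  let ?e = "\<lambda>j :: nat. if j = 1 then 1 else -1 :: three_adic"
  have fixed: "?f x = x" if "x \<in> ?P" for x
    using that m_ge_2 assms by (auto simp: power_0_left)
  have mem: "0 \<in> coset3 0 1" "1 \<in> coset3 1 1" "-1 \<in> coset3 (-1) 1"
    by (simp_all only: mem_coset3_self)
  have union: "(\<Union>x\<in>?I. ?M x) = (coset3 1 1 - {1}) \<union> (coset3 (-1) 1 - {-1})"
  proof -
    \<comment> \<open>Moving the sign index \<open>j\<close> outermost leaves one full family of
      components around each of \<open>1\<close> and \<open>-1\<close>.\<close>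
    have "(\<Union>x\<in>?I. ?M x) = (\<Union>j\<in>{1..2}. \<Union>l. \<Union>a\<in>{0..3 ^ (t - 1) - 1}. \<Union>i\<in>{1..2}. component3 t (?e j) l a i)"
      unfolding set_eq_iff by (simp add: Bex_def) blast
    also have "\<dots> = (\<Union>j\<in>{1..2}. coset3 (?e j) 1 - {?e j})"
      by (simp only: Union_component3[OF t_pos])
    also have "\<dots> = (\<Union>j\<in>{1, 2}. coset3 (?e j) 1 - {?e j})"
      by (rule arg_cong[of _ _ "\<lambda>J. \<Union>j\<in>J. coset3 (?e j) 1 - {?e j}"]) auto
    finally show ?thesis by (simp del: One_nat_def)
  qed
  have "disjoint_family_on ?M ?I"
    unfolding disjoint_family_on_def
  proof (intro ballI impI, rule ccontr)
    fix x y
    assume "x \<in> ?I" "y \<in> ?I" "x \<noteq> y" "?M x \<inter> ?M y \<noteq> {}"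
    then obtain l a i j l' a' i' j' z where
      xy: "x = (l, a, i, j)" "y = (l', a', i', j')"
      and I: "a \<in> {0..3 ^ (t - 1) - 1}" "i \<in> {1..2}" "j \<in> {1..2}"
        "a' \<in> {0..3 ^ (t - 1) - 1}" "i' \<in> {1..2}" "j' \<in> {1..2}"
      and z: "z \<in> component3 t (?e j) l a i" "z \<in> component3 t (?e j') l' a' i'" by blast
    have "z \<in> coset3 (?e j) 1" "z \<in> coset3 (?e j') 1"
      using z component3_subset[OF t_pos] I by blast+
    \<comment> \<open>Components that meet lie in the same class modulo 3, hence around the same
      unit; the other indices then agree by \<open>component3_unique\<close>.\<close>
    then have "?e j = ?e j'" using coset3_mod3_disjoint(3) by (auto split: if_splits)
    moreover have "(1 :: three_adic) \<noteq> -1" using mem coset3_mod3_disjoint(3) by (metis disjoint_iff)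
    ultimately have "j = j'" using I by (auto split: if_splits)
    then show False using component3_unique[OF t_pos z(1) I(1,2)] z(2) I \<open>x \<noteq> y\<close> xy by metis
  qed
  moreover have "\<forall>x\<in>?I. minimal_component ?f (?M x)"
    using pos.minimal_component_component3 neg.minimal_component_component3 by auto
  moreover have "?P = periodic_points ?f"
  proof (intro equalityI subsetI)
    show "x \<in> periodic_points ?f" if "x \<in> ?P" for x using fixed[OF that] by (rule fixed_point_periodic)
    show "x \<in> ?P" if "x \<in> periodic_points ?f" for x
      using that not_periodic_coset3_0[of x] pos.not_periodic[of x] neg.not_periodic[of x]
      by (cases x rule: coset3_mod3_cases) auto
  qed
  moreover have "\<exists>A\<in>attractors ?f ?I ?M. x \<in> attracting_basin ?f A" if "x \<in> ?B" for x
  proof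
    show "{0} \<in> attractors ?f ?I ?M"
      using fixed[of 0] forward_orbit_fixed_point[of ?f 0] fixed_point_periodic[of ?f 0]
      by (force simp: attractors_def)
    show "x \<in> attracting_basin ?f {0}" using that by (simp add: attracting_basin_0)
  qed
  moreover have "?P \<union> (\<Union>x\<in>?I. ?M x) \<union> ?B = UNIV"
    unfolding union using coset3_mod3_cases by blast
  moreover have "?P \<inter> (\<Union>x\<in>?I. ?M x) = {}" "?P \<inter> ?B = {}" "(\<Union>x\<in>?I. ?M x) \<inter> ?B = {}"
    unfolding union using mem coset3_mod3_disjoint by blast+
  moreover have "countable ?I" by (rule countableI_type)
  ultimately show ?thesis
    unfolding minimal_decomposition_def by (intro conjI ballI) (assumption | erule bspec)+
qed

text \<open>Here \<open>-1\<close> is sent to \<open>1\<close>, so only \<open>1\<close> carries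
  components. The second claim says that \<open>B\<close> is the entire union of the basins without
  their attractors, not just contained in it.\<close>

lemma decomposition_even:
  assumes "even m"
  defines "f \<equiv> (\<lambda>x :: three_adic. x ^ m)"
    and "I \<equiv> {(l :: nat, a :: nat, i :: nat). a \<in> {0..3 ^ (t - 1) - 1} \<and> i \<in> {1..2}}"
    and "M \<equiv> (\<lambda>(l, a, i). component3 t 1 l a i)"
    and "B \<equiv> (coset3 0 1 - {0}) \<union> coset3 2 1"
  shows "minimal_decomposition f {0, 1} I M B"
    and "(\<Union>A\<in>attractors f I M. attracting_basin f A - A) = B"
proof -
  interpret pos: power_map_fixed_unit m t q 1 by unfold_locales simp_all
  have fixed: "f x = x" if "x \<in> {0, 1}" for x
    using that m_ge_2 by (auto simp: f_def power_0_left)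
  have f_uminus: "f (- x) = f x" for x using assms(1) by (simp add: f_def)
  have mem: "0 \<in> coset3 0 1" "1 \<in> coset3 1 1" by (simp_all only: mem_coset3_self)
  have union: "(\<Union>x\<in>I. M x) = coset3 1 1 - {1}"
    unfolding Union_component3[OF t_pos, symmetric] by (fastforce simp: I_def M_def)
  have disj: "disjoint_family_on M I"
    unfolding disjoint_family_on_def
  proof (intro ballI impI, rule ccontr)
    fix x y
    assume "x \<in> I" "y \<in> I" "x \<noteq> y" "M x \<inter> M y \<noteq> {}"
    then obtain l a i l' a' i' z where
      xy: "x = (l, a, i)" "y = (l', a', i')"
      and I: "a \<in> {0..3 ^ (t - 1) - 1}" "i \<in> {1..2}" "a' \<in> {0..3 ^ (t - 1) - 1}" "i' \<in> {1..2}"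
      and z: "z \<in> component3 t 1 l a i" "z \<in> component3 t 1 l' a' i'"
      unfolding I_def M_def by blast
    then show False using component3_unique[OF t_pos z(1) I(1,2) z(2) I(3,4)] \<open>x \<noteq> y\<close> by simp
  qed
  have min: "minimal_component f (M x)" if "x \<in> I" for x
    using that pos.minimal_component_component3 by (auto simp: I_def M_def f_def)
  have neg: "-x \<in> coset3 1 1" if "x \<in> coset3 (-1) 1" for x
  proof -
    have "3 dvd - (x + 1)" using that by (simp only: dvd_minus_iff) (simp add: mem_coset3_iff)
    then show ?thesis by (simp add: mem_coset3_iff)
  qed
  have periodic: "periodic_points f = {0, 1}"
  proof (intro equalityI subsetI)
    show "x \<in> periodic_points f" if "x \<in> {0, 1}" for x using fixed[OF that] by (rule fixed_point_periodic)
    show "x \<in> {0, 1}" if x: "x \<in> periodic_points f" for x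
    proof (cases x rule: coset3_mod3_cases)
      case 3
      obtain n where n: "n > 0" "x ^ (m ^ n) = x"
        using x by (auto simp: periodic_points_def f_def funpow_power_map)
      \<comment> \<open>A periodic point in the class of \<open>-1\<close> is an even power of
        \<open>- x\<close>, which lies in the class of \<open>1\<close>; the two classes are
        disjoint.\<close>
      have "even (m ^ n)" using assms(1) n(1) by simp
      then have "(- x) ^ (m ^ n) = x" using n(2) by simp
      then have "x \<in> coset3 1 1" using power_in_coset3_1[OF neg[OF 3], of "m ^ n"] by simp
      then show ?thesis using 3 coset3_mod3_disjoint(3) by blast
    qed (use x not_periodic_coset3_0[of x] pos.not_periodic[of x] in \<open>auto simp: f_def\<close>)
  qed
  have attractors: "attractors f I M = {{0}, {1}} \<union> M ` I"
    unfolding attractors_def periodic using fixed forward_orbit_fixed_point[of f] by auto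
  have invariant: "closed A \<and> A \<noteq> {} \<and> f ` A \<subseteq> A" if "A \<in> attractors f I M" for A
    using that fixed min unfolding attractors by (auto simp: minimal_component_def image_subset_iff)
  \<comment> \<open>The attractors inside the class of \<open>1\<close> fill it, so each
    \<open>- x\<close> with \<open>x\<close> in the class of \<open>-1\<close> already lies in one
    of them.\<close>
  have attractor_1: "\<exists>A\<in>attractors f I M. x \<in> A \<and> A \<subseteq> coset3 1 1" if "x \<in> coset3 1 1" for x
  proof (cases "x = 1")
    case True
    then show ?thesis using mem(2) unfolding attractors by blast
  next
    case False
    then have "x \<in> (\<Union>y\<in>I. M y)" using that unfolding union by blast
    then obtain y where y: "y \<in> I" "x \<in> M y" by blast
    moreover have "M y \<subseteq> coset3 1 1" using union y(1) by blast
    ultimately show ?thesis unfolding attractors by blast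
  qed
  have basin: "\<exists>A\<in>attractors f I M. x \<in> attracting_basin f A - A" if "x \<in> B" for x
  proof (cases "x \<in> coset3 0 1")
    case True
    then have "x \<noteq> 0" using that coset3_mod3_disjoint(2) unfolding B_def coset3_2_eq by blast
    moreover have "x \<in> attracting_basin f {0}" using True by (simp only: f_def attracting_basin_0)
    moreover have "{0} \<in> attractors f I M" by (simp add: attractors)
    ultimately show ?thesis by blast
  next
    case False
    then have x: "x \<in> coset3 (-1) 1" using that unfolding B_def coset3_2_eq by blast
    obtain A where A: "A \<in> attractors f I M" "-x \<in> A" "A \<subseteq> coset3 1 1"
      using attractor_1[OF neg[OF x]] by blast
    have "x \<in> attracting_basin f A"
      using f_uminus[of x, symmetric] A(2) invariant[OF A(1)] by (blast intro: attracting_basin_same_image)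
    moreover have "x \<notin> A" using A(3) x coset3_mod3_disjoint(3) by blast
    ultimately show ?thesis using A(1) by blast
  qed
  have B_compl: "B = - ({0} \<union> coset3 1 1)"
    unfolding B_def coset3_2_eq using coset3_mod3_disjoint coset3_mod3_cases mem(1) by blast
  show "minimal_decomposition f {0, 1} I M B"
    unfolding minimal_decomposition_def
  proof (intro conjI)
    show "{0, 1} \<union> (\<Union>x\<in>I. M x) \<union> B = UNIV" "{0, 1} \<inter> (\<Union>x\<in>I. M x) = {}"
      "{0, 1} \<inter> B = {}" "(\<Union>x\<in>I. M x) \<inter> B = {}"
      unfolding union B_compl using mem coset3_mod3_disjoint(1) by blast+
    show "\<forall>x\<in>B. \<exists>A\<in>attractors f I M. x \<in> attracting_basin f A" using basin by blast
  qed (use disj min periodic in auto)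
  show "(\<Union>A\<in>attractors f I M. attracting_basin f A - A) = B"
  proof (intro equalityI subsetI)
    fix x
    assume "x \<in> (\<Union>A\<in>attractors f I M. attracting_basin f A - A)"
    then obtain A where A: "A \<in> attractors f I M" "x \<in> attracting_basin f A" "x \<notin> A" by blast
    \<comment> \<open>It remains to exclude the fixed points and the components, since
      \<open>B\<close> is the complement of \<open>0\<close> and the class of
      \<open>1\<close>.\<close>
    have not_fixed: "x \<notin> {0, 1}"
      using attracting_basin_fixed_point[OF fixed A(2)] invariant[OF A(1)] A(3) by blast
    have "x \<notin> M y" if y: "y \<in> I" for y
    proof
      assume x: "x \<in> M y"
      have M: "f ` M y \<subseteq> M y" using min[OF y] by (simp add: minimal_component_def)
      obtain l a i where y_eq: "y = (l, a, i)" by (cases y)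
      \<comment> \<open>\<open>A\<close> is a fixed point or another component, because
        \<open>x\<close> lies in \<open>M y\<close> but not in \<open>A\<close>. As
        \<open>M y\<close> is an invariant coset, the orbit of \<open>x\<close> then stays away from
        \<open>A\<close>.\<close>
      have "A \<inter> M y = {}"
      proof (cases "A \<in> {{0}, {1}}")
        case True
        have "M y \<inter> {0, 1} = {}" using union y mem coset3_mod3_disjoint(1) by blast
        then show ?thesis using True by blast
      next
        case False
        then obtain y' where "y' \<in> I" "A = M y'" using A(1) unfolding attractors by blast
        then show ?thesis using disj y x A(3) unfolding disjoint_family_on_def by metis
      qed
      then show False
        using attracting_basin_orbit_in_coset3[of f x _ _ A] funpow_in_invariant[OF M x] A(2) invariant[OF A(1)]
        unfolding y_eq M_def component3_def prod.case by blast
    qed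
    then have "x \<notin> coset3 1 1" using union not_fixed by blast
    then show "x \<in> B" using not_fixed by (simp add: B_compl)
  next
    fix x assume "x \<in> B"
    then show "x \<in> (\<Union>A\<in>attractors f I M. attracting_basin f A - A)" using basin by blast
  qed
qed

end

theorem theorem4p3:
  fixes m t :: nat and f :: "three_adic \<Rightarrow> three_adic"
  assumes "m \<ge> 2" and "[m = 1] (mod 3)"
    and "f = (\<lambda>x. x ^ m)"
    and "t = multiplicity 3 (m - 1)"
  shows
    "([m = 1] (mod 6) \<longrightarrow>
       minimal_decomposition f
         {0, 1, -1}
         {(l, a, i, j). a \<in> {0..3 ^ (t - 1) - 1} \<and> i \<in> {1..2} \<and> j \<in> {1..2}}
         (\<lambda>(l :: nat, a :: nat, i :: nat, j :: nat).
            coset3 ((if j = 1 then 1 else -1) + 3 ^ (l + 1) * of_nat i + 3 ^ (l + 2) * of_nat a)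
              (t + l + 1))
         (coset3 0 1 - {0}) \<and>
       (\<forall>x\<in>{0, 1, -1}. f x = x) \<and>
       attracting_basin f {0} - {0} = coset3 0 1 - {0})
     \<and>
     ([m = 4] (mod 6) \<longrightarrow>
       (let I = {(l, a, i). a \<in> {0..3 ^ (t - 1) - 1} \<and> i \<in> {1..2}};
            M = (\<lambda>(l :: nat, a :: nat, i :: nat).
                   coset3 (1 + 3 ^ (l + 1) * of_nat i + 3 ^ (l + 2) * of_nat a) (t + l + 1));
            B = (coset3 0 1 - {0}) \<union> coset3 2 1
        in minimal_decomposition f {0, 1} I M B \<and>
           (\<forall>x\<in>{0, 1}. f x = x) \<and>
           (\<Union>A\<in>attractors f I M. attracting_basin f A - A) = B))"
proof -
  obtain q where q: "m - 1 = 3 ^ t * q" "\<not> 3 dvd q"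
    using multiplicity_decompose'[of "m - 1" 3] assms(1,4) by auto
  \<comment> \<open>Since \<open>q\<close> is prime to 3, divisibility of \<open>m - 1\<close> by 3
    forces \<open>t \<ge> 1\<close>.\<close>
  have "3 dvd m - 1" using assms(1,2) by (simp add: cong_altdef_nat)
  then have "t \<ge> 1" using q by (cases t) auto
  then interpret power_map m t q using assms(1) q by unfold_locales auto
  show ?thesis
    unfolding assms(3) Let_def
  proof (intro conjI impI)
    assume m: "[m = 1] (mod 6)"
    have "odd m" using m by (auto simp: cong_def) presburger
    then show "\<forall>x\<in>{0, 1, -1}. x ^ m = (x :: three_adic)" using assms(1) by (auto simp: power_0_left)
    show "minimal_decomposition (\<lambda>x. x ^ m) {0, 1, -1}
         {(l, a, i, j). a \<in> {0..3 ^ (t - 1) - 1} \<and> i \<in> {1..2} \<and> j \<in> {1..2}}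
         (\<lambda>(l :: nat, a :: nat, i :: nat, j :: nat).
            coset3 ((if j = 1 then 1 else -1) + 3 ^ (l + 1) * of_nat i + 3 ^ (l + 2) * of_nat a)
              (t + l + 1))
         (coset3 0 1 - {0})"
      using decomposition_odd[OF \<open>odd m\<close>] unfolding component3_def .
  next
    assume m: "[m = 4] (mod 6)"
    then have "even m" by (auto simp: cong_def) presburger
    note decomposition_even[OF this, unfolded component3_def]
    then show "minimal_decomposition (\<lambda>x. x ^ m) {0, 1}
        {(l, a, i). a \<in> {0..3 ^ (t - 1) - 1} \<and> i \<in> {1..2}}
        (\<lambda>(l :: nat, a :: nat, i :: nat).
           coset3 (1 + 3 ^ (l + 1) * of_nat i + 3 ^ (l + 2) * of_nat a) (t + l + 1))
        (coset3 0 1 - {0} \<union> coset3 2 1)"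
      "(\<Union>A\<in>attractors (\<lambda>x. x ^ m) {(l, a, i). a \<in> {0..3 ^ (t - 1) - 1} \<and> i \<in> {1..2}}
        (\<lambda>(l :: nat, a :: nat, i :: nat).
           coset3 (1 + 3 ^ (l + 1) * of_nat i + 3 ^ (l + 2) * of_nat a) (t + l + 1)).
           attracting_basin (\<lambda>x. x ^ m) A - A) = coset3 0 1 - {0} \<union> coset3 2 1"
      by blast+
    show "\<forall>x\<in>{0, 1}. x ^ m = (x :: three_adic)" using assms(1) by (auto simp: power_0_left)
  qed (simp add: attracting_basin_0)
qed

end
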